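(* Let $\sigma$ be a trace and let $S\subseteq\mathsf{Events}(\sigma)$ be a $(\le^\sigma_{TO},\mathsf{rf}_\sigma)$-closed set. Then the optimistic-reordering-graph $G^{\mathsf{Opt}}_S$ has a cycle if and only if the abstract optimistic-reordering-graph $G^{\mathsf{Abs}}_S$ has a cycle.
   Context: **Traces.** A trace $\sigma$ is a finite sequence of events; each event $e$ has a unique identifier, a thread $\mathsf{th}(e)$ and an operation $\mathsf{op}(e)$, which is one of $\mathsf{r}(x)$, $\mathsf{w}(x)$ (read/write of variable $x$), $\mathsf{acq}(\ell)$, $\mathsf{rel}(\ell)$ (acquire/release of lock $\ell$). $\mathsf{Events}(\sigma)$ is its set of events. Traces are well-formed: for each lock $\ell$, the operations on $\ell$ alternate between acquires and releases, each release being preceded by a matching acquire of the same thread. For an acquire (release) $e$, $\mathsf{match}_\sigma(e)$ is its matching release (acquire) in $\sigma$, or $\bot$ if none exists. **Orders.** $e_1\le^\sigma_{tr}e_2$ iff $e_1=e_2$ or $e_1$ appears before $e_2$ in $\sigma$; $e_1\le^\sigma_{TO}e_2$ iff $\mathsf{th}(e_1)=\mathsf{th}(e_2)$ and $e_1\le^\sigma_{tr}e_2$. For a read $r$ of $x$, $\mathsf{rf}_\sigma(r)$ is the last write on $x$ before $r$ in $\sigma$ (assumed always to exist). $\mathsf{prev}_\sigma(e)$ is the last event $f\neq e$ with $f\le^\sigma_{TO}e$, if one exists. A set $S\subseteq\mathsf{Events}(\sigma)$ is $(\le^\sigma_{TO},\mathsf{rf}_\sigma)$-closed if it is downward closed under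 $\le^\sigma_{TO}$ and contains $\mathsf{rf}_\sigma(r)$ for each read $r\in S$. Two events conflict if they access the same variable and at least one is a write. An acquire or release $e\in S$ is matched in $S$ if $\mathsf{match}_\sigma(e)\in S$. **Optimistic-reordering-graph** $G^{\mathsf{Opt}}_S$: the directed graph with vertex set $S$ and the following edges between elements of $S$: - (thread) $(e,e')$ with $e=\mathsf{prev}_\sigma(e')$; - (conflict) $(e,e')$ with $e,e'$ conflicting, $e\neq e'$, $e\le^\sigma_{tr}e'$, and no intermediate event in $\sigma$ (whether or not it belongs to $S$) that conflicts with both $e$ and $e'$; - (match) $(r,a')$ with $r\le^\sigma_{tr}a'$, $\mathsf{op}(r)=\mathsf{rel}(\ell)$, $\mathsf{op}(a')=\mathsf{acq}(\ell)$ for a common lock $\ell$, $r$ and $a'$ both matched in $S$, and no intermediate critical section on $\ell$ (between $r$ and $a'$); - (unmatch) $(r,a')$ with $\mathsf{op}(r)=\mathsf{rel}(\ell)$, $\mathsf{op}(a')=\mathsf{acq}(\ell)$ for a common lock $\ell$, and $\mathsf{match}_\sigma(a')\notin S$. **Abstract optimistic-reordering-graph** $G^{\mathsf{Abs}}_S$: its vertices are, for every lock $\ell$, the last (in $\le^\sigma_{tr}$) release event on $\ell$ present in $S$ (if any), together with all acquire events $a\in S$ on $\ell$ with $\mathsf{match}_\sigma(a)\notin S$. There is an edge $(e,e')$ iff there is a path (of length at least one) from $e$ to $e'$ in $G^{\mathsf{Opt}}_S$. *)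

theory Defs
  imports "Graph_Theory.Graph_Theory"
begin

datatype ('x, 'l) operation = Read 'x | Write 'x | Acq 'l | Rel 'l

datatype ('i, 't, 'x, 'l) event =
  Event (ident: 'i) (th: 't) (opn: "('x, 'l) operation")

type_synonym ('i, 't, 'x, 'l) trace = "('i, 't, 'x, 'l) event list"

definition lock_ops :: "'l \<Rightarrow> ('i, 't, 'x, 'l) trace \<Rightarrow> ('i, 't, 'x, 'l) event list" where
  "lock_ops l \<sigma> = filter (\<lambda>e. opn e = Acq l \<or> opn e = Rel l) \<sigma>"

text \<open>The operations on a lock alternate and start with an acquire, so the acquires are those at
  even positions; a release has the same thread as the acquire just before it. The last conjunct
  is the standing assumption that every read has a write to read from.\<close>

definition wf_trace :: "('i, 't, 'x, 'l) trace \<Rightarrow> bool" where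
  "wf_trace \<sigma> \<longleftrightarrow>
     distinct (map ident \<sigma>) \<and>
     (\<forall>l. \<forall>i < length (lock_ops l \<sigma>).
        (even i \<longrightarrow> opn (lock_ops l \<sigma> ! i) = Acq l) \<and>
        (odd i \<longrightarrow> opn (lock_ops l \<sigma> ! i) = Rel l \<and>
                   th (lock_ops l \<sigma> ! i) = th (lock_ops l \<sigma> ! (i - 1)))) \<and>
     (\<forall>j < length \<sigma>. \<forall>x. opn (\<sigma> ! j) = Read x \<longrightarrow> (\<exists>i < j. opn (\<sigma> ! i) = Write x))"

definition tr_le :: "('i, 't, 'x, 'l) trace \<Rightarrow> ('i, 't, 'x, 'l) event \<Rightarrow> ('i, 't, 'x, 'l) event \<Rightarrow> bool" where
  "tr_le \<sigma> e f \<longleftrightarrow> (\<exists>i j. i \<le> j \<and> j < length \<sigma> \<and> \<sigma> ! i = e \<and> \<sigma> ! j = f)"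

definition to_le :: "('i, 't, 'x, 'l) trace \<Rightarrow> ('i, 't, 'x, 'l) event \<Rightarrow> ('i, 't, 'x, 'l) event \<Rightarrow> bool" where
  "to_le \<sigma> e f \<longleftrightarrow> th e = th f \<and> tr_le \<sigma> e f"

text \<open>The last event strictly before \<open>e\<close>, and the first one strictly after \<open>e\<close>, that satisfies
  \<open>P\<close> (for \<open>e\<close> an event of a trace without repetitions).\<close>

definition last_before ::
  "('i, 't, 'x, 'l) trace \<Rightarrow> ('i, 't, 'x, 'l) event \<Rightarrow> (('i, 't, 'x, 'l) event \<Rightarrow> bool)
   \<Rightarrow> ('i, 't, 'x, 'l) event option" where
  "last_before \<sigma> e P = find P (rev (takeWhile (\<lambda>f. f \<noteq> e) \<sigma>))"

definition first_after ::
  "('i, 't, 'x, 'l) trace \<Rightarrow> ('i, 't, 'x, 'l) event \<Rightarrow> (('i, 't, 'x, 'l) event \<Rightarrow> bool)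
   \<Rightarrow> ('i, 't, 'x, 'l) event option" where
  "first_after \<sigma> e P = find P (tl (dropWhile (\<lambda>f. f \<noteq> e) \<sigma>))"

definition rf :: "('i, 't, 'x, 'l) trace \<Rightarrow> ('i, 't, 'x, 'l) event \<Rightarrow> ('i, 't, 'x, 'l) event option" where
  "rf \<sigma> r = (case opn r of
       Read x \<Rightarrow> last_before \<sigma> r (\<lambda>w. opn w = Write x)
     | _ \<Rightarrow> None)"

definition prev :: "('i, 't, 'x, 'l) trace \<Rightarrow> ('i, 't, 'x, 'l) event \<Rightarrow> ('i, 't, 'x, 'l) event option" where
  "prev \<sigma> e = last_before \<sigma> e (\<lambda>f. th f = th e)"

text \<open>In a well-formed trace the release following an acquire of the same lock, and the acquire
  preceding a release, belong to the same thread. \<open>None\<close> stands for the value bottom.\<close>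

definition match :: "('i, 't, 'x, 'l) trace \<Rightarrow> ('i, 't, 'x, 'l) event \<Rightarrow> ('i, 't, 'x, 'l) event option" where
  "match \<sigma> e = (case opn e of
       Acq l \<Rightarrow> first_after \<sigma> e (\<lambda>f. opn f = Rel l)
     | Rel l \<Rightarrow> last_before \<sigma> e (\<lambda>f. opn f = Acq l)
     | _ \<Rightarrow> None)"

definition matched_in ::
  "('i, 't, 'x, 'l) trace \<Rightarrow> ('i, 't, 'x, 'l) event set \<Rightarrow> ('i, 't, 'x, 'l) event \<Rightarrow> bool" where
  "matched_in \<sigma> S e \<longleftrightarrow> (\<exists>f\<in>S. match \<sigma> e = Some f)"

definition to_rf_closed :: "('i, 't, 'x, 'l) trace \<Rightarrow> ('i, 't, 'x, 'l) event set \<Rightarrow> bool" where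
  "to_rf_closed \<sigma> S \<longleftrightarrow>
     (\<forall>f\<in>S. \<forall>e\<in>set \<sigma>. to_le \<sigma> e f \<longrightarrow> e \<in> S) \<and>
     (\<forall>r\<in>S. \<forall>w. rf \<sigma> r = Some w \<longrightarrow> w \<in> S)"

definition conflicting :: "('i, 't, 'x, 'l) event \<Rightarrow> ('i, 't, 'x, 'l) event \<Rightarrow> bool" where
  "conflicting e f \<longleftrightarrow> (\<exists>x. opn e \<in> {Read x, Write x} \<and> opn f \<in> {Read x, Write x} \<and>
     (opn e = Write x \<or> opn f = Write x))"

definition thread_edge ::
  "('i, 't, 'x, 'l) trace \<Rightarrow> ('i, 't, 'x, 'l) event \<Rightarrow> ('i, 't, 'x, 'l) event \<Rightarrow> bool" where
  "thread_edge \<sigma> e e' \<longleftrightarrow> prev \<sigma> e' = Some e"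

definition conflict_edge ::
  "('i, 't, 'x, 'l) trace \<Rightarrow> ('i, 't, 'x, 'l) event \<Rightarrow> ('i, 't, 'x, 'l) event \<Rightarrow> bool" where
  "conflict_edge \<sigma> e e' \<longleftrightarrow>
     conflicting e e' \<and> e \<noteq> e' \<and> tr_le \<sigma> e e' \<and>
     \<not> (\<exists>g\<in>set \<sigma>. g \<noteq> e \<and> g \<noteq> e' \<and> tr_le \<sigma> e g \<and> tr_le \<sigma> g e' \<and>
          conflicting g e \<and> conflicting g e')"

text \<open>The critical sections that block a match edge are those present in \<open>S\<close>, with both their
  acquire and their release: a match edge links consecutive critical sections of \<open>S\<close>, whatever
  critical sections outside \<open>S\<close> (or only entered in \<open>S\<close>) the trace has in between.\<close>

definition match_edge ::
  "('i, 't, 'x, 'l) trace \<Rightarrow> ('i, 't, 'x, 'l) event set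
   \<Rightarrow> ('i, 't, 'x, 'l) event \<Rightarrow> ('i, 't, 'x, 'l) event \<Rightarrow> bool" where
  "match_edge \<sigma> S r a' \<longleftrightarrow>
     tr_le \<sigma> r a' \<and>
     (\<exists>l. opn r = Rel l \<and> opn a' = Acq l \<and>
        matched_in \<sigma> S r \<and> matched_in \<sigma> S a' \<and>
        \<not> (\<exists>a\<in>S. \<exists>f\<in>S. opn a = Acq l \<and> match \<sigma> a = Some f \<and> tr_le \<sigma> r a \<and> tr_le \<sigma> f a'))"

definition unmatch_edge ::
  "('i, 't, 'x, 'l) trace \<Rightarrow> ('i, 't, 'x, 'l) event set
   \<Rightarrow> ('i, 't, 'x, 'l) event \<Rightarrow> ('i, 't, 'x, 'l) event \<Rightarrow> bool" where
  "unmatch_edge \<sigma> S r a' \<longleftrightarrow>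
     (\<exists>l. opn r = Rel l \<and> opn a' = Acq l) \<and> \<not> matched_in \<sigma> S a'"

definition opt_graph ::
  "('i, 't, 'x, 'l) trace \<Rightarrow> ('i, 't, 'x, 'l) event set
   \<Rightarrow> ('i, 't, 'x, 'l) event pair_pre_digraph" where
  "opt_graph \<sigma> S =
     \<lparr> pverts = S,
       parcs = {(e, e') \<in> S \<times> S. thread_edge \<sigma> e e' \<or> conflict_edge \<sigma> e e' \<or>
                  match_edge \<sigma> S e e' \<or> unmatch_edge \<sigma> S e e'} \<rparr>"

definition abs_verts ::
  "('i, 't, 'x, 'l) trace \<Rightarrow> ('i, 't, 'x, 'l) event set \<Rightarrow> ('i, 't, 'x, 'l) event set" where
  "abs_verts \<sigma> S =
     (\<Union>l. {r\<in>S. opn r = Rel l \<and> (\<forall>r'\<in>S. opn r' = Rel l \<longrightarrow> tr_le \<sigma> r' r)} \<union>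
          {a\<in>S. opn a = Acq l \<and> \<not> matched_in \<sigma> S a})"

text \<open>A path of length at least one may be closed, so a vertex on a cycle of the
  optimistic-reordering-graph gets a loop in the abstract one.\<close>

definition abs_graph ::
  "('i, 't, 'x, 'l) trace \<Rightarrow> ('i, 't, 'x, 'l) event set
   \<Rightarrow> ('i, 't, 'x, 'l) event pair_pre_digraph" where
  "abs_graph \<sigma> S =
     \<lparr> pverts = abs_verts \<sigma> S,
       parcs = {(e, e') \<in> abs_verts \<sigma> S \<times> abs_verts \<sigma> S.
                  e \<rightarrow>\<^sup>+\<^bsub>with_proj (opt_graph \<sigma> S)\<^esub> e'} \<rparr>"

definition has_cycle :: "'a pair_pre_digraph \<Rightarrow> bool" where
  "has_cycle G \<longleftrightarrow> (\<exists>p. pre_digraph.cycle (with_proj G) p)"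

end

(* Thread, conflict and match edges of the optimistic-reordering-graph strictly advance in the trace
   order, so every cycle uses an unmatch edge. The target of that edge is an acquire unmatched in S,
   hence a vertex of the abstract graph, and it carries a loop there because it lies on a cycle of the
   optimistic-reordering-graph. Conversely, every abstract edge unfolds to a path. *)
theory Submission
  imports Defs
begin

text \<open>Library cycles are closed arc walks without repeated inner vertices. Every nonempty
  closed walk contains one, so cycle questions reduce to the transitive closure of the arcs.\<close>

lemma has_cycle_iff_trancl:
  assumes "parcs G \<subseteq> pverts G \<times> pverts G"
  shows "has_cycle G \<longleftrightarrow> (\<exists>u. (u, u) \<in> (parcs G)\<^sup>+)"
proof -
  interpret pair_wf_digraph G
    using assms by unfold_locales auto
  have "(\<exists>p. cycle p) \<longleftrightarrow> (\<exists>p. closed_w p)"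
    using closed_w_imp_cycle cycle_altdef by blast
  also have "\<dots> \<longleftrightarrow> (\<exists>u. (u, u) \<in> (parcs G)\<^sup>+)"
    using reachable1_awalk by (auto simp: closed_w_def)
  finally show ?thesis
    by (simp add: has_cycle_def)
qed

text \<open>If every step of a path increases \<open>f\<close>, transitivity compares the endpoints.
  Otherwise some step fails to, and the two \<open>rtrancl\<close> facts place it on the
  path.\<close>

lemma trancl_increasing_or_descent:
  fixes f :: "'a \<Rightarrow> 'b::order"
  assumes "(u, v) \<in> R\<^sup>+"
  shows "f u < f v \<or> (\<exists>x y. (x, y) \<in> R \<and> \<not> f x < f y \<and> (u, x) \<in> R\<^sup>* \<and> (y, v) \<in> R\<^sup>*)"
  using assms
proof (induction rule: trancl_induct)
  case (base y)
  then show ?case by blast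
next
  case (step y z)
  show ?case
  proof (cases "f y < f z")
    case True
    with step show ?thesis
      by (meson less_trans rtrancl.rtrancl_into_rtrancl)
  next
    case False
    with step show ?thesis
      by (meson rtrancl.rtrancl_refl trancl_into_rtrancl)
  qed
qed

text \<open>\<open>f u < f u\<close> is impossible, so some step of the cycle does not increase
  \<open>f\<close>; rotating the cycle makes it start at the target of that step.\<close>

lemma cycle_has_descent:
  fixes f :: "'a \<Rightarrow> 'b::order"
  assumes "(u, u) \<in> R\<^sup>+"
  obtains x y where "(x, y) \<in> R" "\<not> f x < f y" "(y, y) \<in> R\<^sup>+"
proof -
  from trancl_increasing_or_descent[OF assms, of f]
  obtain x y where "(x, y) \<in> R" "\<not> f x < f y" "(u, x) \<in> R\<^sup>*" "(y, u) \<in> R\<^sup>*"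
    by auto
  moreover from this have "(y, y) \<in> R\<^sup>+"
    by (meson rtrancl_into_trancl1 rtrancl_trans)
  ultimately show thesis
    by (intro that)
qed

text \<open>The index of the first occurrence, written with the same \<open>takeWhile\<close> prefix
  that \<open>last_before\<close> searches.\<close>

definition position :: "'a list \<Rightarrow> 'a \<Rightarrow> nat" where
  "position xs x = length (takeWhile (\<lambda>y. y \<noteq> x) xs)"

lemma position_nth:
  assumes "distinct xs" "i < length xs"
  shows "position xs (xs ! i) = i"
proof -
  have "takeWhile (\<lambda>y. y \<noteq> xs ! i) xs = take i xs"
    using assms by (intro takeWhile_eq_take_P_nth) (auto simp: nth_eq_iff_index_eq)
  with assms(2) show ?thesis
    by (simp add: position_def)
qed

lemma position_less_length: "x \<in> set xs \<Longrightarrow> position xs x < length xs"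
  unfolding position_def by (induction xs) auto

lemma position_less_if_tr_le:
  assumes "distinct \<sigma>" "tr_le \<sigma> e f" "e \<noteq> f"
  shows "position \<sigma> e < position \<sigma> f"
  using assms by (auto simp: tr_le_def position_nth order.order_iff_strict)

lemma position_less_if_last_before:
  assumes "last_before \<sigma> e P = Some f"
  shows "position \<sigma> f < position \<sigma> e"
proof -
  let ?before = "takeWhile (\<lambda>g. g \<noteq> e) \<sigma>"
  have "f \<in> set ?before"
    using assms unfolding last_before_def by (metis find_Some_iff nth_mem set_rev)
  then have "position ?before f < length ?before"
    by (rule position_less_length)
  \<comment> \<open>The first occurrence of \<open>f\<close> already lies in the prefix, so the rest
    of the trace does not affect its index.\<close>
  moreover have "position \<sigma> f = position ?before f"
    using \<open>f \<in> set ?before\<close>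
      takeWhile_append1[of f ?before "\<lambda>g. g \<noteq> f" "dropWhile (\<lambda>g. g \<noteq> e) \<sigma>"]
    by (simp add: position_def)
  ultimately show ?thesis
    by (simp add: position_def)
qed

lemma position_less_if_edge:
  assumes "distinct \<sigma>"
    and "thread_edge \<sigma> e e' \<or> conflict_edge \<sigma> e e' \<or> match_edge \<sigma> S e e'"
  shows "position \<sigma> e < position \<sigma> e'"
  using assms position_less_if_last_before position_less_if_tr_le
  unfolding thread_edge_def prev_def conflict_edge_def match_edge_def
  \<comment> \<open>An acquire differs from a release, so the ends of a match edge are distinct and
    \<open>tr_le\<close> between them is strict.\<close>
  by (metis operation.distinct(11))

theorem lemma4p4:
  fixes \<sigma> :: "('i, 't, 'x, 'l) trace"
    and S :: "('i, 't, 'x, 'l) event set"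
  assumes "wf_trace \<sigma>"
    and "S \<subseteq> set \<sigma>"
    and "to_rf_closed \<sigma> S"
  shows "has_cycle (opt_graph \<sigma> S) \<longleftrightarrow> has_cycle (abs_graph \<sigma> S)"
proof -
  let ?R = "parcs (opt_graph \<sigma> S)" and ?A = "parcs (abs_graph \<sigma> S)"
  have opt: "has_cycle (opt_graph \<sigma> S) \<longleftrightarrow> (\<exists>u. (u, u) \<in> ?R\<^sup>+)"
    by (rule has_cycle_iff_trancl) (auto simp: opt_graph_def)
  have abs: "has_cycle (abs_graph \<sigma> S) \<longleftrightarrow> (\<exists>u. (u, u) \<in> ?A\<^sup>+)"
    by (rule has_cycle_iff_trancl) (auto simp: abs_graph_def)
  have A: "?A = {(e, e') \<in> abs_verts \<sigma> S \<times> abs_verts \<sigma> S. (e, e') \<in> ?R\<^sup>+}"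
    by (simp add: abs_graph_def)
  have "distinct \<sigma>"
    using assms(1) by (auto simp: wf_trace_def distinct_map)
  have "\<exists>a. (a, a) \<in> ?A\<^sup>+" if "(u, u) \<in> ?R\<^sup>+" for u
  proof -
    from that obtain r a
      where "(r, a) \<in> ?R" "\<not> position \<sigma> r < position \<sigma> a" and loop: "(a, a) \<in> ?R\<^sup>+"
      by (rule cycle_has_descent)
    with position_less_if_edge[OF \<open>distinct \<sigma>\<close>] have "a \<in> S" "unmatch_edge \<sigma> S r a"
      by (auto simp: opt_graph_def)
    then have "a \<in> abs_verts \<sigma> S"
      by (auto simp: unmatch_edge_def abs_verts_def)
    with loop show ?thesis
      unfolding A by blast
  qed
  \<comment> \<open>Each abstract arc lies in \<open>?R\<^sup>+\<close>, which is its own transitive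
    closure.\<close>
  moreover have "?A\<^sup>+ \<subseteq> ?R\<^sup>+"
    using trancl_mono_subset[of ?A "?R\<^sup>+"] unfolding A by auto
  ultimately show ?thesis
    unfolding opt abs by blast
qed

end
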